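(* Let $I(x)=\frac12(1+x)\log(1+x)+\frac12(1-x)\log(1-x)$. The function $\phi$ defined by $\phi(x):=xI'(x)/I(x)$ for $x\in(0,1)$ and $\phi(0)=2$ is continuous and strictly increasing on $[0,1)$ with range $[2,\infty)$. Moreover, for every integer $p\ge2$, with $\xi_p(x)=x^p/p!$, $$\beta_f(p)=\sqrt{I(x_\star)/\xi_p(x_\star)},\qquad\text{where } x_\star:=\phi^{-1}(p).$$
   Context: Here $\beta_f(p):=\inf_{x\in(0,1)}\sqrt{I(x)/\xi_p(x)}$. For $p=2$ one has $x_\star=0$ and the expression $I(x_\star)/\xi_2(x_\star)$ is understood as the limit of $I(x)/\xi_2(x)$ as $x\downarrow0$. *)

theory Defs imports "HOL-Analysis.Analysis" begin

text \<open>With \<open>ln 0 = 0\<close> the formula also gives the usual value \<open>ln 2\<close> at \<open>x = 1\<close> and \<open>x = -1\<close>.\<close>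

definition rate_I :: "real \<Rightarrow> real" where
  "rate_I x = 1/2 * (1 + x) * ln (1 + x) + 1/2 * (1 - x) * ln (1 - x)"

definition xi :: "nat \<Rightarrow> real \<Rightarrow> real" where
  "xi p x = x ^ p / fact p"

definition beta_f :: "nat \<Rightarrow> real" where
  "beta_f p = (INF x\<in>{0<..<1}. sqrt (rate_I x / xi p x))"

text \<open>Only the values on \<open>{0..<1}\<close> are meaningful.\<close>

definition phi :: "real \<Rightarrow> real" where
  "phi x = (if x = 0 then 2 else x * deriv rate_I x / rate_I x)"

definition x_star :: "nat \<Rightarrow> real" where
  "x_star p = the_inv_into {0..<1} phi (real p)"

text \<open>The quotient at \<open>x = 0\<close> (needed for \<open>p = 2\<close>, where \<open>x_star 2 = 0\<close>) is its
  right limit. \<open>Lim\<close> is unspecified if there is no limit, so existence of the limit has to be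
  asserted separately wherever this value is used.\<close>

definition I_over_xi :: "nat \<Rightarrow> real \<Rightarrow> real" where
  "I_over_xi p x =
     (if x = 0 then Lim (at_right 0) (\<lambda>y. rate_I y / xi p y) else rate_I x / xi p x)"

end

theory Submission imports Defs begin

text \<open>The derivative of \<open>I\<close> is \<open>artanh\<close>, and \<open>x I'(x) = I(x) + L(x)\<close> with
  \<open>L(x) = - ln (1 - x\<^sup>2) / 2\<close>, so \<open>\<phi> = 1 + L / I\<close> on \<open>(0, 1)\<close>. Both \<open>L\<close> and \<open>I\<close>
  vanish at \<open>0\<close>, and so do the numerator and the denominator of
  \<open>L'(x) / I'(x) = (x / (1 - x\<^sup>2)) / artanh x\<close>. One more differentiation of both leaves
  \<open>(1 + x\<^sup>2) / (1 - x\<^sup>2)\<close>, which is visibly strictly increasing. The monotone form of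
  l'Hopital's rule (\<open>quotient_strict_mono\<close>), applied twice, carries this monotonicity back to
  \<open>L / I\<close> and hence to \<open>\<phi>\<close>. Cauchy's mean value theorem
  (\<open>quotient_eq_derivative_quotient\<close>), applied along the same two steps, gives
  \<open>2 < \<phi>(x) < 1 + (1 + x\<^sup>2) / (1 - x\<^sup>2)\<close>, so \<open>\<phi>\<close> is continuous at \<open>0\<close> with value \<open>2\<close>.
  Since \<open>I\<close> is bounded and \<open>L\<close> is not, \<open>\<phi>\<close> is unbounded, and the intermediate value theorem
  yields the range.

  The function \<open>\<phi>\<close> governs the quotient \<open>I / \<xi>\<^sub>p\<close>, because
  \<open>(I / \<xi>\<^sub>p)'(x) = I(x) / (x \<xi>\<^sub>p(x)) \<cdot> (\<phi>(x) - p)\<close> (\<open>rate_I_over_xi_deriv\<close>). As \<open>\<phi>\<close> is increasing,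
  the quotient decreases up to the point where \<open>\<phi> = p\<close> and increases afterwards, so for
  \<open>p > 2\<close> this point is a minimum in \<open>(0, 1)\<close>. For \<open>p = 2\<close> the infimum is not attained; the
  bounds \<open>1 < I(x) / \<xi>\<^sub>2(x) < 1 / (1 - x\<^sup>2)\<close> identify it with the limit \<open>1\<close> at \<open>0\<close>.\<close>

section \<open>The monotone form of l'Hopital's rule\<close>

lemma increment_ratio:
  fixes f g f' g' :: "real \<Rightarrow> real"
  assumes f: "\<And>t. a \<le> t \<Longrightarrow> t < b \<Longrightarrow> (f has_real_derivative f' t) (at t)"
    and g: "\<And>t. a \<le> t \<Longrightarrow> t < b \<Longrightarrow> (g has_real_derivative g' t) (at t)"
    and pos: "\<And>t. a < t \<Longrightarrow> t < b \<Longrightarrow> 0 < g' t"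
    and xy: "a \<le> x" "x < y" "y < b"
  obtains c where "x < c" "c < y" "f y - f x = f' c / g' c * (g y - g x)"
proof -
  have "\<exists>c. x < c \<and> c < y \<and> (f y - f x) * g' c = (g y - g x) * f' c"
    using xy by (intro GMVT') (auto intro!: f g DERIV_isCont)
  then obtain c where c: "x < c" "c < y" and eq: "(f y - f x) * g' c = (g y - g x) * f' c"
    by blast
  have "g' c \<noteq> 0"
    using pos[of c] c xy by simp
  with eq have "f y - f x = f' c / g' c * (g y - g x)"
    by (simp add: field_simps)
  with c show thesis
    by (rule that)
qed

lemma increment_pos:
  fixes g g' :: "real \<Rightarrow> real"
  assumes g: "\<And>t. a \<le> t \<Longrightarrow> t < b \<Longrightarrow> (g has_real_derivative g' t) (at t)"
    and pos: "\<And>t. a < t \<Longrightarrow> t < b \<Longrightarrow> 0 < g' t"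
    and xy: "a \<le> x" "x < y" "y < b"
  shows "g x < g y"
proof -
  obtain c where "x < c" "c < y" "g y - g x = (y - x) * g' c"
    using MVT2[of x y g g'] g xy by auto
  with pos[of c] xy show ?thesis
    by (smt (verit) mult_pos_pos)
qed

lemma quotient_eq_derivative_quotient:
  fixes f g f' g' :: "real \<Rightarrow> real"
  assumes f: "\<And>t. a \<le> t \<Longrightarrow> t < b \<Longrightarrow> (f has_real_derivative f' t) (at t)"
    and g: "\<And>t. a \<le> t \<Longrightarrow> t < b \<Longrightarrow> (g has_real_derivative g' t) (at t)"
    and pos: "\<And>t. a < t \<Longrightarrow> t < b \<Longrightarrow> 0 < g' t"
    and zero: "f a = 0" "g a = 0"
    and x: "a < x" "x < b"
  obtains c where "a < c" "c < x" "f x / g x = f' c / g' c"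
proof -
  have "g x > 0"
    using increment_pos[where a=a and b=b, OF g pos, of a x] x zero by simp
  moreover obtain c where "a < c" "c < x" "f x - f a = f' c / g' c * (g x - g a)"
    using increment_ratio[where a=a and b=b, OF f g pos, of a x] x by auto
  ultimately show thesis
    using that[of c] zero by simp
qed

text \<open>Between \<open>a\<close> and \<open>x\<close> the mean slope of \<open>f\<close> relative to \<open>g\<close> is \<open>f x / g x\<close>, and it is a value of
  \<open>f' / g'\<close> before \<open>x\<close>; between \<open>x\<close> and \<open>y\<close> it is a value of \<open>f' / g'\<close> after \<open>x\<close>, hence larger.
  The quotient at \<open>y\<close> is the average of these two slopes weighted by the increments of \<open>g\<close>.\<close>

lemma quotient_strict_mono:
  fixes f g f' g' :: "real \<Rightarrow> real"
  assumes f: "\<And>t. a \<le> t \<Longrightarrow> t < b \<Longrightarrow> (f has_real_derivative f' t) (at t)"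
    and g: "\<And>t. a \<le> t \<Longrightarrow> t < b \<Longrightarrow> (g has_real_derivative g' t) (at t)"
    and pos: "\<And>t. a < t \<Longrightarrow> t < b \<Longrightarrow> 0 < g' t"
    and zero: "f a = 0" "g a = 0"
    and mono: "strict_mono_on {a<..<b} (\<lambda>t. f' t / g' t)"
  shows "strict_mono_on {a<..<b} (\<lambda>t. f t / g t)"
proof (rule strict_mono_onI)
  fix x y assume "x \<in> {a<..<b}" "y \<in> {a<..<b}" and xy: "x < y"
  then have x: "a < x" "x < b" and y: "a < y" "y < b" by auto
  obtain c where c: "a < c" "c < x" and fx: "f x / g x = f' c / g' c"
    using quotient_eq_derivative_quotient[where a=a and b=b, OF f g pos zero x] by blast
  obtain d where d: "x < d" "d < y" and fy: "f y - f x = f' d / g' d * (g y - g x)"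
    using increment_ratio[where a=a and b=b, OF f g pos, of x y] x xy y by auto
  have gx: "0 < g x" and gxy: "g x < g y"
    using increment_pos[where a=a and b=b, OF g pos, of a x]
      increment_pos[where a=a and b=b, OF g pos, of x y] x xy y zero
    by auto
  have "f' c / g' c < f' d / g' d"
    using strict_mono_onD[OF mono, of c d] c d x y by auto
  then have "f' c / g' c * (g y - g x) < f y - f x"
    unfolding fy using gxy by (intro mult_strict_right_mono) auto
  moreover have "f x = f' c / g' c * g x"
    using fx gx by (simp add: field_simps)
  ultimately have "f' c / g' c * g y < f y"
    by (simp add: right_diff_distrib)
  then show "f x / g x < f y / g y"
    unfolding fx using gx gxy by (simp add: pos_less_divide_eq)
qed

section \<open>The rate function and \<open>\<phi>\<close>\<close>

text \<open>A closed form of \<open>x I'(x) - I(x)\<close>, which is the Legendre transform of \<open>I\<close> at the slope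
  \<open>I'(x)\<close>.\<close>

definition legendre_rate_I :: "real \<Rightarrow> real" where
  "legendre_rate_I x = - ln (1 - x\<^sup>2) / 2"

lemma one_minus_square_pos: "0 < 1 - x\<^sup>2" if "0 \<le> x" "x < 1" for x :: real
  using that power_strict_mono[of x 1 2] by simp

lemma rate_I_deriv: "(rate_I has_real_derivative artanh x) (at x)" if "0 \<le> x" "x < 1"
proof -
  have "((\<lambda>x. (1 + x) * ln (1 + x)) has_real_derivative ln (1 + x) + 1) (at x)"
    using that by (auto intro!: derivative_eq_intros)
  moreover have "((\<lambda>x. (1 - x) * ln (1 - x)) has_real_derivative - ln (1 - x) - 1) (at x)"
    using that by (auto intro!: derivative_eq_intros)
  ultimately have "((\<lambda>x. ((1 + x) * ln (1 + x) + (1 - x) * ln (1 - x)) / 2) has_real_derivative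
      (ln (1 + x) + 1 + (- ln (1 - x) - 1)) / 2) (at x)"
    by (intro DERIV_cdivide DERIV_add)
  moreover have "(\<lambda>x. ((1 + x) * ln (1 + x) + (1 - x) * ln (1 - x)) / 2) = rate_I"
    by (simp add: fun_eq_iff rate_I_def add_divide_distrib)
  ultimately show ?thesis
    using that by (simp add: artanh_def ln_div)
qed

lemma legendre_rate_I_deriv: "(legendre_rate_I has_real_derivative x / (1 - x\<^sup>2)) (at x)" if "0 \<le> x" "x < 1"
  using that one_minus_square_pos[OF that] unfolding legendre_rate_I_def[abs_def]
  by (auto intro!: derivative_eq_intros simp: field_simps)

lemma artanh_deriv: "(artanh has_real_derivative 1 / (1 - x\<^sup>2)) (at x)" if "0 \<le> x" "x < (1::real)"
  using that artanh_real_has_field_derivative[of x UNIV] by simp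

lemma x_over_one_minus_square_deriv:
  "((\<lambda>x. x / (1 - x\<^sup>2)) has_real_derivative (1 + x\<^sup>2) / (1 - x\<^sup>2)\<^sup>2) (at x)" if "0 \<le> x" "x < 1"
  using one_minus_square_pos[OF that]
  by (auto intro!: derivative_eq_intros simp: field_simps power2_eq_square)

lemma artanh_pos: "0 < artanh x" if "0 < x" "x < (1::real)"
  using increment_pos[where a=0 and b=1, OF artanh_deriv, of 0 x] that one_minus_square_pos by auto

lemma rate_I_0 [simp]: "rate_I 0 = 0" and legendre_rate_I_0 [simp]: "legendre_rate_I 0 = 0"
  by (simp_all add: rate_I_def legendre_rate_I_def)

lemma rate_I_pos: "0 < rate_I x" if "0 < x" "x < 1"
  using increment_pos[where a=0 and b=1, OF rate_I_deriv, of 0 x] that artanh_pos by auto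

lemma x_artanh_eq: "x * artanh x = rate_I x + legendre_rate_I x" if "0 \<le> x" "x < 1"
proof -
  have "1 - x\<^sup>2 = (1 - x) * (1 + x)"
    by (simp add: power2_eq_square algebra_simps)
  with that have "ln (1 - x\<^sup>2) = ln (1 - x) + ln (1 + x)"
    by (simp add: ln_mult)
  then show ?thesis
    using that by (simp add: artanh_def rate_I_def legendre_rate_I_def ln_div field_simps)
qed

lemma phi_eq: "phi x = x * artanh x / rate_I x" if "0 < x" "x < 1"
  using that DERIV_imp_deriv[OF rate_I_deriv, of x] by (simp add: phi_def)

lemma phi_eq_legendre: "phi x = 1 + legendre_rate_I x / rate_I x" if "0 < x" "x < 1"
  using that rate_I_pos[OF that] by (simp add: phi_eq x_artanh_eq field_simps)

section \<open>Monotonicity, continuity and range of \<open>\<phi>\<close>\<close>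

lemma second_derivative_quotient:
  "(1 + t\<^sup>2) / (1 - t\<^sup>2)\<^sup>2 / (1 / (1 - t\<^sup>2)) = (1 + t\<^sup>2) / (1 - t\<^sup>2)" for t :: real
  by (simp add: power2_eq_square)

lemma one_plus_over_one_minus_square_less: "(1 + s\<^sup>2) / (1 - s\<^sup>2) < (1 + t\<^sup>2) / (1 - t\<^sup>2)"
  if "0 \<le> s" "s < t" "t < 1" for s t :: real
  using that one_minus_square_pos[of s] one_minus_square_pos[of t] power_strict_mono[of s t 2]
  by (intro frac_less) auto

lemma legendre_derivative_quotient_strict_mono:
  "strict_mono_on {0<..<1} (\<lambda>t::real. t / (1 - t\<^sup>2) / artanh t)"
proof (rule quotient_strict_mono[OF x_over_one_minus_square_deriv artanh_deriv])
  show "strict_mono_on {0<..<1} (\<lambda>t::real. (1 + t\<^sup>2) / (1 - t\<^sup>2)\<^sup>2 / (1 / (1 - t\<^sup>2)))"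
    unfolding second_derivative_quotient by (intro strict_mono_onI one_plus_over_one_minus_square_less) auto
qed (simp_all add: one_minus_square_pos del: diff_gt_0_iff_gt)

lemma phi_strict_mono_interior: "strict_mono_on {0<..<1} phi"
proof -
  have "strict_mono_on {0<..<1} (\<lambda>t. legendre_rate_I t / rate_I t)"
    by (rule quotient_strict_mono[OF legendre_rate_I_deriv rate_I_deriv _ _ _
          legendre_derivative_quotient_strict_mono]) (auto simp: artanh_pos)
  then show ?thesis
    by (auto simp: strict_mono_on_def phi_eq_legendre)
qed

text \<open>Cauchy's mean value theorem, used twice, turns \<open>L(x) / I(x)\<close> into the value of
  \<open>(1 + d\<^sup>2) / (1 - d\<^sup>2)\<close> at some \<open>d\<close> strictly between \<open>0\<close> and \<open>x\<close>. The bounds give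
  \<open>\<phi>(0+) = 2\<close> and also place the value at \<open>0\<close> strictly below all others.\<close>

lemma phi_bounds: "2 < phi x \<and> phi x < 1 + (1 + x\<^sup>2) / (1 - x\<^sup>2)" if x: "0 < x" "x < 1"
proof -
  obtain c where c: "0 < c" "c < x" "legendre_rate_I x / rate_I x = c / (1 - c\<^sup>2) / artanh c"
    using quotient_eq_derivative_quotient[where a=0 and b=1, OF legendre_rate_I_deriv rate_I_deriv, of x]
      x artanh_pos by auto
  obtain d where d: "0 < d" "d < c"
    "c / (1 - c\<^sup>2) / artanh c = (1 + d\<^sup>2) / (1 - d\<^sup>2)\<^sup>2 / (1 / (1 - d\<^sup>2))"
    using quotient_eq_derivative_quotient[where a=0 and b=1, OF x_over_one_minus_square_deriv artanh_deriv, of c]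
      x c one_minus_square_pos by auto
  have "phi x = 1 + (1 + d\<^sup>2) / (1 - d\<^sup>2)"
    using x c d second_derivative_quotient[of d] by (simp add: phi_eq_legendre)
  then show ?thesis
    using one_plus_over_one_minus_square_less[of 0 d] one_plus_over_one_minus_square_less[of d x] c d x by simp
qed

lemma phi_strict_mono: "strict_mono_on {0..<1} phi"
proof (rule strict_mono_onI)
  fix x y :: real assume "x \<in> {0..<1}" "y \<in> {0..<1}" "x < y"
  then show "phi x < phi y"
    using phi_bounds[of y] strict_mono_onD[OF phi_strict_mono_interior, of x y]
    by (cases "x = 0") (auto simp: phi_def)
qed

lemma phi_tendsto_0: "(phi \<longlongrightarrow> 2) (at_right 0)"
proof (rule tendsto_sandwich)
  have "\<forall>\<^sub>F x in at_right (0::real). x \<in> {0<..<1}"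
    by (intro eventually_at_right_real) simp
  then show "\<forall>\<^sub>F x in at_right 0. 2 \<le> phi x"
    and "\<forall>\<^sub>F x in at_right 0. phi x \<le> 1 + (1 + x\<^sup>2) / (1 - x\<^sup>2)"
    using phi_bounds by (auto elim!: eventually_mono simp: less_imp_le)
  have "((\<lambda>x::real. 1 + (1 + x\<^sup>2) / (1 - x\<^sup>2)) \<longlongrightarrow> 1 + (1 + 0\<^sup>2) / (1 - 0\<^sup>2)) (at_right 0)"
    by (intro tendsto_intros) auto
  then show "((\<lambda>x::real. 1 + (1 + x\<^sup>2) / (1 - x\<^sup>2)) \<longlongrightarrow> 2) (at_right 0)"
    by simp
qed simp

lemma phi_continuous: "continuous_on {0..<1} phi"
  unfolding continuous_on_eq_continuous_within
proof
  fix x :: real assume x: "x \<in> {0..<1}"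
  show "continuous (at x within {0..<1}) phi"
  proof (cases "x = 0")
    case True
    have "(phi \<longlongrightarrow> 2) (at 0 within {0..1})"
      using phi_tendsto_0 by (simp add: at_within_Icc_at_right)
    then have "(phi \<longlongrightarrow> 2) (at 0 within {0..<1})"
      by (rule tendsto_within_subset) auto
    then show ?thesis
      by (simp add: True continuous_within phi_def)
  next
    case False
    with x have x01: "0 < x" "x < 1" by auto
    have "isCont (\<lambda>t. t * artanh t / rate_I t) x"
      using x01 rate_I_pos[OF x01]
      by (intro continuous_intros DERIV_isCont[OF rate_I_deriv] DERIV_isCont[OF artanh_deriv]) auto
    moreover have "\<forall>\<^sub>F t in nhds x. t \<in> {0<..<1}"
      using x01 by (intro eventually_nhds_in_open) auto
    then have "\<forall>\<^sub>F t in nhds x. phi t = t * artanh t / rate_I t"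
      by (rule eventually_mono) (simp add: phi_eq)
    ultimately have "isCont phi x"
      by (simp add: isCont_cong)
    then show ?thesis
      by (rule continuous_at_imp_continuous_at_within)
  qed
qed

lemma rate_I_le_1: "rate_I x \<le> 1" if "0 < x" "x < 1"
proof -
  have "(1 + x) * ln (1 + x) \<le> 2 * 1"
    using that ln_le_minus_one[of "1 + x"] by (intro mult_mono) auto
  moreover have "(1 - x) * ln (1 - x) \<le> 0"
    using that by (intro mult_nonneg_nonpos) auto
  ultimately show ?thesis
    by (simp add: rate_I_def)
qed

text \<open>Since \<open>I \<le> 1\<close>, one has \<open>\<phi> \<ge> 1 + L\<close> wherever \<open>L \<ge> 0\<close>, and \<open>L\<close> can be inverted explicitly.
  Replacing \<open>v\<close> by \<open>max v 1\<close> keeps the resulting point away from \<open>0\<close>.\<close>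

lemma phi_unbounded: "\<exists>x\<in>{0<..<1}. v \<le> phi x"
proof -
  define w where "w = max v 1"
  \<comment> \<open>the solution of \<open>L x = w\<close>\<close>
  define x where "x = sqrt (1 - exp (- 2 * w))"
  have x: "0 < x" "x < 1" and x2: "x\<^sup>2 = 1 - exp (- 2 * w)"
    by (auto simp: x_def w_def)
  have legendre: "legendre_rate_I x = w"
    by (simp add: legendre_rate_I_def x2)
  have "0 \<le> w"
    by (simp add: w_def)
  then have "w \<le> w / rate_I x"
    using rate_I_pos[OF x] rate_I_le_1[OF x] by (simp add: pos_le_divide_eq mult_left_le)
  then have "v \<le> phi x"
    using x legendre by (simp add: phi_eq_legendre w_def)
  with x show ?thesis by auto
qed

lemma phi_image: "phi ` {0..<1} = {2..}"
proof
  show "phi ` {0..<1} \<subseteq> {2..}"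
  proof (rule image_subsetI)
    fix x :: real assume "x \<in> {0..<1}"
    then show "phi x \<in> {2..}"
      using phi_bounds[of x] by (cases "x = 0") (auto simp: phi_def)
  qed
  show "{2..} \<subseteq> phi ` {0..<1}"
  proof
    fix v :: real assume "v \<in> {2..}"
    moreover obtain y where y: "0 < y" "y < 1" "v \<le> phi y"
      using phi_unbounded[of v] by auto
    moreover have "continuous_on {0..y} phi"
      using y by (intro continuous_on_subset[OF phi_continuous]) auto
    ultimately obtain x where "0 \<le> x" "x \<le> y" "phi x = v"
      using IVT'[of phi 0 v y] by (auto simp: phi_def)
    with y show "v \<in> phi ` {0..<1}"
      by (intro image_eqI[of v phi x]) auto
  qed
qed

lemma x_star: "x_star p \<in> {0..<1}" "phi (x_star p) = real p" if "2 \<le> p"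
proof -
  have inj: "inj_on phi {0..<1}"
    by (rule strict_mono_on_imp_inj_on[OF phi_strict_mono])
  have p: "real p \<in> phi ` {0..<1}"
    using that by (simp add: phi_image)
  show "phi (x_star p) = real p"
    unfolding x_star_def by (rule f_the_inv_into_f[OF inj p])
  show "x_star p \<in> {0..<1}"
    unfolding x_star_def by (rule the_inv_into_into[OF inj p order_refl])
qed

lemma x_star_2: "x_star 2 = 0"
  using the_inv_into_f_f[OF strict_mono_on_imp_inj_on[OF phi_strict_mono], of 0]
  by (simp add: x_star_def phi_def)

section \<open>The quotient \<open>I / \<xi>\<^sub>2\<close> near \<open>0\<close>\<close>

text \<open>Two differentiations of numerator and denominator turn \<open>I(x) / (x\<^sup>2 / 2)\<close> into
  \<open>artanh c / c\<close> and then into \<open>1 / (1 - d\<^sup>2)\<close> with \<open>0 < d < c < x\<close>.\<close>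

lemma rate_I_over_xi_2_bounds:
  "1 < rate_I x / xi 2 x \<and> rate_I x / xi 2 x < 1 / (1 - x\<^sup>2)" if x: "0 < x" "x < 1"
proof -
  have xi: "(xi 2 has_real_derivative t) (at t)" for t :: real
    unfolding xi_def[abs_def] by (auto intro!: derivative_eq_intros)
  obtain c where c: "0 < c" "c < x" "rate_I x / xi 2 x = artanh c / c"
    using quotient_eq_derivative_quotient[where a=0 and b=1, OF rate_I_deriv xi, of x] x by (auto simp: xi_def)
  obtain d where d: "0 < d" "d < c" "artanh c / c = 1 / (1 - d\<^sup>2) / 1"
    using quotient_eq_derivative_quotient[where a=0 and b=1, OF artanh_deriv DERIV_ident, of c] x c by auto
  have "0 < d\<^sup>2" "d\<^sup>2 < x\<^sup>2" "x\<^sup>2 < 1"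
    using c d x power_strict_mono[of d x 2] one_minus_square_pos[of x] by auto
  then show ?thesis
    unfolding c(3) d(3) by (auto simp: field_simps)
qed

lemma rate_I_over_xi_2_tendsto: "((\<lambda>x. rate_I x / xi 2 x) \<longlongrightarrow> 1) (at_right 0)"
proof (rule tendsto_sandwich)
  have "\<forall>\<^sub>F x in at_right (0::real). x \<in> {0<..<1}"
    by (intro eventually_at_right_real) simp
  then show "\<forall>\<^sub>F x in at_right 0. 1 \<le> rate_I x / xi 2 x"
    and "\<forall>\<^sub>F x in at_right 0. rate_I x / xi 2 x \<le> 1 / (1 - x\<^sup>2)"
    using rate_I_over_xi_2_bounds by (auto elim!: eventually_mono simp: less_imp_le)
  have "((\<lambda>x::real. 1 / (1 - x\<^sup>2)) \<longlongrightarrow> 1 / (1 - 0\<^sup>2)) (at_right 0)"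
    by (intro tendsto_intros) auto
  then show "((\<lambda>x::real. 1 / (1 - x\<^sup>2)) \<longlongrightarrow> 1) (at_right 0)"
    by simp
qed simp

lemma I_over_xi_2_0: "I_over_xi 2 0 = 1"
  using tendsto_Lim[OF _ rate_I_over_xi_2_tendsto] by (simp add: I_over_xi_def)

section \<open>Minimising \<open>I / \<xi>\<^sub>p\<close>\<close>

lemma xi_pos: "0 < xi p x" if "0 < x"
  using that by (simp add: xi_def)

lemma xi_deriv: "(xi p has_real_derivative real p * xi p x / x) (at x)" if "0 < x"
proof -
  have "x ^ p * real p = x * (real p * x ^ (p - 1))"
    by (cases p) auto
  then show ?thesis
    using that unfolding xi_def[abs_def] by (auto intro!: derivative_eq_intros simp: field_simps)
qed

text \<open>The logarithmic derivative of \<open>I / \<xi>\<^sub>p\<close> is \<open>I' / I - p / x = (\<phi>(x) - p) / x\<close>. This is what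
  makes \<open>\<phi>\<close> the right function to invert.\<close>

lemma rate_I_over_xi_deriv:
  "((\<lambda>t. rate_I t / xi p t) has_real_derivative
      rate_I x / (x * xi p x) * (phi x - real p)) (at x)"
  if x: "0 < x" "x < 1"
proof -
  have "((\<lambda>t. rate_I t / xi p t) has_real_derivative
      (artanh x * xi p x - rate_I x * (real p * xi p x / x)) / (xi p x * xi p x)) (at x)"
    using x xi_pos[of x p] by (intro DERIV_divide rate_I_deriv xi_deriv) auto
  also have "(artanh x * xi p x - rate_I x * (real p * xi p x / x)) / (xi p x * xi p x)
      = rate_I x / (x * xi p x) * (phi x - real p)"
    using x xi_pos[of x p] rate_I_pos[OF x] by (simp add: phi_eq field_simps)
  finally show ?thesis .
qed

text \<open>By monotonicity of \<open>\<phi>\<close>, the derivative of the quotient is nonpositive before \<open>s\<close> and nonnegative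
  after it.\<close>

lemma rate_I_over_xi_minimum:
  "rate_I s / xi p s \<le> rate_I x / xi p x"
  if s: "0 < s" "s < 1" "phi s = real p" and x: "0 < x" "x < 1"
proof (cases "x \<le> s")
  case True
  show ?thesis
  proof (rule DERIV_nonpos_imp_nonincreasing[OF True])
    fix t assume t: "x \<le> t" "t \<le> s"
    then have "phi t \<le> real p"
      using s x strict_mono_onD[OF phi_strict_mono, of t s] by (cases "t = s") auto
    then have "rate_I t / (t * xi p t) * (phi t - real p) \<le> 0"
      using s x t rate_I_pos[of t] xi_pos[of t p] by (intro mult_nonneg_nonpos) auto
    then show "\<exists>y. ((\<lambda>t. rate_I t / xi p t) has_real_derivative y) (at t) \<and> y \<le> 0"
      using rate_I_over_xi_deriv[of t p] s x t by auto
  qed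
next
  case False
  then have "s \<le> x" by simp
  then show ?thesis
  proof (rule DERIV_nonneg_imp_nondecreasing)
    fix t assume t: "s \<le> t" "t \<le> x"
    then have "real p \<le> phi t"
      using s x strict_mono_onD[OF phi_strict_mono, of s t] by (cases "t = s") auto
    then have "0 \<le> rate_I t / (t * xi p t) * (phi t - real p)"
      using s x t rate_I_pos[of t] xi_pos[of t p] by (intro mult_nonneg_nonneg) auto
    then show "\<exists>y. ((\<lambda>t. rate_I t / xi p t) has_real_derivative y) (at t) \<and> 0 \<le> y"
      using rate_I_over_xi_deriv[of t p] s x t by auto
  qed
qed

text \<open>The quotient exceeds \<open>1\<close> on all of \<open>(0, 1)\<close> and tends to \<open>1\<close> at the excluded end point \<open>0\<close>.\<close>

lemma beta_f_2: "beta_f 2 = 1"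
proof (rule antisym)
  show "1 \<le> beta_f 2"
    unfolding beta_f_def
  proof (rule cINF_greatest)
    show "1 \<le> sqrt (rate_I x / xi 2 x)" if "x \<in> {0<..<1}" for x
      using rate_I_over_xi_2_bounds[of x] that by simp
  qed simp
  have "bdd_below ((\<lambda>x. sqrt (rate_I x / xi 2 x)) ` {0<..<1})"
    using rate_I_over_xi_2_bounds by (intro bdd_belowI2[of _ 1]) (auto simp: less_imp_le)
  then have "beta_f 2 \<le> sqrt (rate_I x / xi 2 x)" if "x \<in> {0<..<1}" for x
    unfolding beta_f_def using that by (rule cINF_lower)
  then have "\<forall>\<^sub>F x in at_right 0. beta_f 2 \<le> sqrt (rate_I x / xi 2 x)"
    by (rule eventually_mono[OF eventually_at_right_real[OF zero_less_one]])
  moreover have "((\<lambda>x. sqrt (rate_I x / xi 2 x)) \<longlongrightarrow> 1) (at_right 0)"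
    using tendsto_real_sqrt[OF rate_I_over_xi_2_tendsto] by simp
  ultimately show "beta_f 2 \<le> 1"
    by (intro tendsto_lowerbound[of _ 1 "at_right 0"]) auto
qed

lemma beta_f_eq_at_critical_point:
  "beta_f p = sqrt (rate_I s / xi p s)" if "0 < s" "s < 1" "phi s = real p"
  unfolding beta_f_def
proof (rule cInf_eq_minimum)
  show "sqrt (rate_I s / xi p s) \<in> (\<lambda>x. sqrt (rate_I x / xi p x)) ` {0<..<1}"
    using that by auto
  show "sqrt (rate_I s / xi p s) \<le> y" if "y \<in> (\<lambda>x. sqrt (rate_I x / xi p x)) ` {0<..<1}" for y
    using that rate_I_over_xi_minimum[OF \<open>0 < s\<close> \<open>s < 1\<close> \<open>phi s = real p\<close>] by auto
qed

lemma beta_f_eq: "beta_f p = sqrt (I_over_xi p (x_star p))" if p: "2 \<le> p"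
proof (cases "p = 2")
  case True
  then show ?thesis
    by (simp add: beta_f_2 x_star_2 I_over_xi_2_0)
next
  case False
  with x_star(2)[OF p] have "x_star p \<noteq> 0"
    by (auto simp: phi_def)
  with x_star[OF p] show ?thesis
    using beta_f_eq_at_critical_point[of "x_star p" p] by (simp add: I_over_xi_def)
qed

theorem lemma1p6:
  "continuous_on {0..<1} phi
   \<and> strict_mono_on {0..<1} phi
   \<and> phi ` {0..<1} = {2..}
   \<and> x_star 2 = 0
   \<and> ((\<lambda>x. rate_I x / xi 2 x) \<longlongrightarrow> I_over_xi 2 0) (at_right 0)
   \<and> (\<forall>p\<ge>2. beta_f p = sqrt (I_over_xi p (x_star p)))"
  using phi_continuous phi_strict_mono phi_image x_star_2 rate_I_over_xi_2_tendsto beta_f_eq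
  by (simp add: I_over_xi_2_0)

end
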